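(* Let $\delta>0$, $\eta>0$, $\lambda>0$, $n=\lceil\delta\rceil$, and let $\nu>0$ be such that $\nu n\in(0,1)$. Let $N(t)$, $t\ge0$, be a homogeneous Poisson process of rate $\lambda$ independent of the process ${}_\eta\mathfrak{V}_t^{\nu,\delta}$, $t\ge0$. Then the probabilities $p_k(t)=\mathbb{P}\{N({}_\eta\mathfrak{V}_t^{\nu,\delta})=k\}$, $k\ge0$, $t\ge0$, are solutions to $$\begin{cases}\dfrac{\mathrm d}{\mathrm dt}p_k(t)=-\left\{\left[\eta+\lambda^\nu(1-B)^\nu\right]^\delta-\eta^\delta\right\}p_k(t),\\[4pt] p_k(0)=\delta_{k,0},\end{cases}$$ where $B$ is the backward-shift operator in $k$ and $\delta_{k,0}$ is the Kronecker delta.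
   Context: A subordinator is a process $S_t$, $t\ge0$, starting from zero, with increasing paths and with independent and stationary increments; its Laplace exponent $\Phi$ is defined by $\mathbb{E}e^{-\mu S_t}=e^{-t\Phi(\mu)}$. For $\beta\in(0,1)$, a $\beta$-stable subordinator $V_t^\beta$ has Laplace exponent $\mu^\beta$. With $\nu n\in(0,1)$, let $V^{\nu r}_t$, $r=1,\dots,n$, be independent $\nu r$-stable subordinators and ${}_\eta\mathcal{V}_t^{\nu,n}=\sum_{r=1}^n\binom{n}{r}^{1/(\nu r)}\eta^{(n-r)/(\nu r)}V_t^{\nu r}$. Let $\mathscr{V}_t^{\delta/n}$ be a subordinator, independent of the $V^{\nu r}$, with Laplace exponent $(\eta^n+\mu)^{\delta/n}-\eta^\delta$. Define ${}_\eta\mathfrak{V}_t^{\nu,\delta}={}_\eta\mathcal{V}^{\nu,n}_{\mathscr{V}_t^{\delta/n}}$. $B$ acts by $B(f_k)=f_{k-1}$, $B^r(f_k)=B(B^{r-1}(f_k))$, and $p_k\equiv0$ for $k<0$. The operator $[\eta+\lambda^\nu(1-B)^\nu]^\delta-\eta^\delta$ is the power series in $B$ obtained from the expansion at $z=0$ of $[\eta+\lambda^\nu(1-z)^\nu]^\delta-\eta^\delta=\sum_{j\ge0}c_jz^j$, i.e. it maps $p_k$ to $\sum_{j=0}^k c_j\,p_{k-j}$; formally it equals $\sum_{r=1}^\infty\binom{\delta}{r}\eta^{\delta-r}\lambda^{\nu r}\sum_{m=0}^\infty\binom{\nu r}{m}(-1)^mB^m$. *)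

theory Defs
  imports "HOL-Probability.Probability"
begin

text \<open>
  Time is modelled by \<open>real\<close>; only the values of a process at times \<open>t \<ge> 0\<close> matter.
\<close>

text \<open>
  The sub-\<open>\<sigma>\<close>-algebra generated by the family \<open>X i\<close>, \<open>i \<in> I\<close>. Independence of whole processes
  is independence of the \<open>\<sigma>\<close>-algebras they generate.
\<close>

definition generated_sigma ::
    "'a measure \<Rightarrow> 'b measure \<Rightarrow> 'i set \<Rightarrow> ('i \<Rightarrow> 'a \<Rightarrow> 'b) \<Rightarrow> 'a set set" where
  "generated_sigma M K I X =
     sigma_sets (space M) {X i -` A \<inter> space M | i A. i \<in> I \<and> A \<in> sets K}"

definition independent_increments ::
    "'a measure \<Rightarrow> 'b::minus measure \<Rightarrow> (real \<Rightarrow> 'a \<Rightarrow> 'b) \<Rightarrow> bool" where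
  "independent_increments M K X \<longleftrightarrow>
     (\<forall>(m::nat) s. 0 \<le> s 0 \<and> (\<forall>i<m. s i < s (Suc i)) \<longrightarrow>
        prob_space.indep_vars M (\<lambda>_. K) (\<lambda>i \<omega>. X (s (Suc i)) \<omega> - X (s i) \<omega>) {..<m})"

definition stationary_increments ::
    "'a measure \<Rightarrow> 'b::minus measure \<Rightarrow> (real \<Rightarrow> 'a \<Rightarrow> 'b) \<Rightarrow> bool" where
  "stationary_increments M K X \<longleftrightarrow>
     (\<forall>t\<ge>0. \<forall>h\<ge>0.
        distr M K (\<lambda>\<omega>. X (t + h) \<omega> - X t \<omega>) = distr M K (\<lambda>\<omega>. X h \<omega> - X 0 \<omega>))"

text \<open>
  ``Increasing'' is meant in the weak sense: the deterministic process \<open>t\<close>, with Laplace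
  exponent \<open>\<mu>\<close>, is a subordinator. No path regularity beyond monotonicity is imposed.
\<close>

definition subordinator :: "'a measure \<Rightarrow> (real \<Rightarrow> 'a \<Rightarrow> real) \<Rightarrow> bool" where
  "subordinator M S \<longleftrightarrow>
     (\<forall>t\<ge>0. S t \<in> borel_measurable M) \<and>
     (\<forall>\<omega>\<in>space M. S 0 \<omega> = 0 \<and> mono_on {0..} (\<lambda>t. S t \<omega>)) \<and>
     independent_increments M borel S \<and>
     stationary_increments M borel S"

definition has_laplace_exponent ::
    "'a measure \<Rightarrow> (real \<Rightarrow> 'a \<Rightarrow> real) \<Rightarrow> (real \<Rightarrow> real) \<Rightarrow> bool" where
  "has_laplace_exponent M S \<Phi> \<longleftrightarrow>
     (\<forall>t\<ge>0. \<forall>\<mu>\<ge>0. (\<integral>\<omega>. exp (- \<mu> * S t \<omega>) \<partial>M) = exp (- t * \<Phi> \<mu>))"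

definition stable_subordinator :: "'a measure \<Rightarrow> real \<Rightarrow> (real \<Rightarrow> 'a \<Rightarrow> real) \<Rightarrow> bool" where
  "stable_subordinator M \<beta> S \<longleftrightarrow>
     0 < \<beta> \<and> \<beta> < 1 \<and> subordinator M S \<and> has_laplace_exponent M S (\<lambda>\<mu>. \<mu> powr \<beta>)"

definition poisson_process :: "'a measure \<Rightarrow> real \<Rightarrow> (real \<Rightarrow> 'a \<Rightarrow> nat) \<Rightarrow> bool" where
  "poisson_process M rate N \<longleftrightarrow>
     (\<forall>t\<ge>0. N t \<in> measurable M (count_space UNIV)) \<and>
     (\<forall>\<omega>\<in>space M. N 0 \<omega> = 0 \<and> mono_on {0..} (\<lambda>t. N t \<omega>) \<and>
        (\<forall>t\<ge>0. continuous (at_right t) (\<lambda>s. N s \<omega>))) \<and>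
     independent_increments M (count_space UNIV) N \<and>
     (\<forall>s t. 0 \<le> s \<and> s < t \<longrightarrow>
        distr M (count_space UNIV) (\<lambda>\<omega>. N t \<omega> - N s \<omega>) =
        measure_pmf (poisson_pmf (rate * (t - s))))"

definition stable_mixture ::
    "real \<Rightarrow> real \<Rightarrow> nat \<Rightarrow> (nat \<Rightarrow> real \<Rightarrow> 'a \<Rightarrow> real) \<Rightarrow> real \<Rightarrow> 'a \<Rightarrow> real" where
  "stable_mixture \<eta> \<nu> n V t \<omega> =
     (\<Sum>r=1..n. real (n choose r) powr (1 / (\<nu> * real r)) *
                 \<eta> powr (real (n - r) / (\<nu> * real r)) * V r t \<omega>)"

definition time_change ::
    "(real \<Rightarrow> 'a \<Rightarrow> 'b) \<Rightarrow> (real \<Rightarrow> 'a \<Rightarrow> real) \<Rightarrow> real \<Rightarrow> 'a \<Rightarrow> 'b" where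
  "time_change X S t \<omega> = X (S t \<omega>) \<omega>"

definition state_prob :: "'a measure \<Rightarrow> (real \<Rightarrow> 'a \<Rightarrow> nat) \<Rightarrow> nat \<Rightarrow> real \<Rightarrow> real" where
  "state_prob M X k t = measure M {\<omega> \<in> space M. X t \<omega> = k}"

text \<open>Sequences are indexed by \<open>nat\<close>; the convention \<open>f\<^sub>k = 0\<close> for \<open>k < 0\<close> is built into the shift.\<close>

definition backshift :: "(nat \<Rightarrow> real) \<Rightarrow> nat \<Rightarrow> real" where
  "backshift f k = (if k = 0 then 0 else f (k - 1))"

lemma backshift_funpow: "(backshift ^^ j) f k = (if j \<le> k then f (k - j) else 0)"
  by (induction j arbitrary: k) (auto simp: backshift_def)

text \<open>
  \<open>g(B)\<close> for a function \<open>g\<close> that is analytic at \<open>0\<close>, with expansion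
  \<open>g(z) = (\<Sum>j. c\<^sub>j z\<^sup>j)\<close>, \<open>c\<^sub>j = g\<^bsup>(j)\<^esup>(0) / j!\<close>. The terms with \<open>j > k\<close> of the power series in \<open>B\<close>
  vanish at \<open>k\<close>.
\<close>

definition backshift_series :: "(real \<Rightarrow> real) \<Rightarrow> (nat \<Rightarrow> real) \<Rightarrow> nat \<Rightarrow> real" where
  "backshift_series g f k = (\<Sum>j\<le>k. (deriv ^^ j) g 0 / fact j * (backshift ^^ j) f k)"

end

theory Submission
  imports Defs
begin

text \<open>
  Write \<open>T\<^sub>t\<close> for the random clock. Conditioning on \<open>W\<close> gives the Laplace transform
  \<open>E exp (- \<mu> T\<^sub>t) = exp (- t ((\<eta> + \<mu>\<^sup>\<nu>)\<^sup>\<delta> - \<eta>\<^sup>\<delta>))\<close>, because the binomial weights make the mixture have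
  Laplace exponent \<open>(\<eta> + \<mu>\<^sup>\<nu>)\<^sup>n - \<eta>\<^sup>n\<close>. Conditioning on \<open>T\<^sub>t\<close> then yields, at \<open>\<mu> = \<lambda> (1 - z)\<close>,
  the generating function \<open>\<Sum>\<^sub>k p\<^sub>k(t) z\<^sup>k = exp (- t g(z))\<close>, where \<open>g(B)\<close> is the operator of the equation.
  As formal power series, \<open>P\<^sub>t' = - t g' P\<^sub>t\<close> (derivatives in \<open>z\<close>) determines the coefficients
  recursively, and induction on \<open>k\<close> turns this into \<open>dP\<^sub>t/dt = - g P\<^sub>t\<close>.
  Conditioning on a clock is done by approximating it by clocks on the grids \<open>{j/m}\<close>.
\<close>

subsection \<open>Coefficients of \<open>exp (- t g)\<close>\<close>

text \<open>Differentiating a function applies \<open>fps_deriv\<close> to its expansion; iterate.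
  This identifies the numbers \<open>(deriv ^^ j) g 0 / fact j\<close> in
  \<open>backshift_series\<close> with formal coefficients.\<close>

lemma has_fps_expansion_higher_deriv:
  fixes f :: "real \<Rightarrow> real"
  assumes "f has_fps_expansion F"
  shows "(deriv ^^ n) f 0 = fact n * fps_nth F n"
  using assms
proof (induction n arbitrary: f F)
  case 0
  then show ?case
    by (auto simp: has_fps_expansion_def eval_fps_at_0 dest: eventually_nhds_x_imp_x)
next
  case (Suc n)
  have "(deriv ^^ Suc n) f 0 = (deriv ^^ n) (deriv f) 0"
    by (simp add: funpow_swap1)
  also have "\<dots> = fact n * fps_nth (fps_deriv F) n"
    by (intro Suc.IH has_fps_expansion_deriv Suc.prems)
  finally show ?case
    by (simp add: algebra_simps)
qed

text \<open>Reduces an identity between formal power series to exhibiting one function that both of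
  them expand.\<close>

lemma has_fps_expansion_real_unique:
  fixes f :: "real \<Rightarrow> real"
  assumes "f has_fps_expansion F" "f has_fps_expansion G"
  shows "F = G"
proof (rule fps_ext)
  fix n
  have "fact n * fps_nth F n = fact n * fps_nth G n"
    using assms[THEN has_fps_expansion_higher_deriv, of n] by simp
  then show "fps_nth F n = fps_nth G n"
    by simp
qed

lemma has_fps_expansion_eventually_cong:
  assumes "f has_fps_expansion F" "eventually (\<lambda>z. f z = g z) (nhds 0)"
  shows "g has_fps_expansion F"
  using assms unfolding has_fps_expansion_def by (auto elim: eventually_elim2)

text \<open>Near 0 the function coincides with \<open>eval_fps F\<close>, which is differentiable
  inside its disc of convergence. A whole neighbourhood is covered, so that functions built from
  \<open>deriv f\<close> can be compared near 0 and not only at 0.\<close>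

lemma has_fps_expansion_eventually_DERIV:
  fixes f :: "real \<Rightarrow> real"
  assumes "f has_fps_expansion F"
  shows "eventually (\<lambda>z. (f has_real_derivative deriv f z) (at z)) (nhds 0)"
proof -
  let ?E = "eball (0::real) (fps_conv_radius F)"
  obtain S where S: "open S" "0 \<in> S" "\<And>z. z \<in> S \<Longrightarrow> eval_fps F z = f z"
    using assms unfolding has_fps_expansion_def eventually_nhds by blast
  have "eventually (\<lambda>z. z \<in> S \<inter> ?E) (nhds 0)"
    using assms S by (intro eventually_nhds_in_open)
      (auto simp: has_fps_expansion_def zero_ereal_def)
  then show ?thesis
  proof eventually_elim
    case (elim z)
    then have "(eval_fps F has_real_derivative eval_fps (fps_deriv F) z) (at z)"
      by (intro has_field_derivative_eval_fps) simp
    then have "(f has_real_derivative eval_fps (fps_deriv F) z) (at z)"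
      by (rule has_field_derivative_transform_within_open[where S = S]) (use S elim in auto)
    then show ?case
      by (simp add: DERIV_deriv_iff_has_field_derivative[symmetric] DERIV_imp_deriv)
  qed
qed

text \<open>With \<open>P t\<close> the generating function and \<open>C\<close> the Taylor series
  of \<open>g\<close> at 0, the claim is that \<open>P t\<close> has coefficientwise
  \<open>t\<close>-derivative \<open>- C * P t\<close>. Both the smoothness of \<open>g\<close> near
  0 and the differentiability in \<open>t\<close> are extracted from \<open>sums\<close>.\<close>

lemma exp_power_series_coeff_DERIV:
  fixes p :: "nat \<Rightarrow> real \<Rightarrow> real" and g :: "real \<Rightarrow> real"
  assumes sums: "\<And>t z. t \<ge> 0 \<Longrightarrow> \<bar>z\<bar> < 1 \<Longrightarrow> (\<lambda>k. p k t * z ^ k) sums exp (- t * g z)"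
    and "t \<ge> 0"
  shows "(p k has_real_derivative - (\<Sum>j\<le>k. (deriv ^^ j) g 0 / fact j * p (k - j) t))
           (at t within {0..})"
proof -
  define P where "P t = Abs_fps (\<lambda>k. p k t)" for t
  define C where "C = Abs_fps (\<lambda>j. (deriv ^^ j) g 0 / fact j)"
  have ev: "eventually (\<lambda>z::real. z \<in> ball 0 1) (nhds 0)"
    by (intro eventually_nhds_in_open) auto
  have P: "(\<lambda>z. exp (- t * g z)) has_fps_expansion P t" if "t \<ge> 0" for t
    by (rule has_fps_expansionI, rule eventually_mono[OF ev]) (use sums[OF that] in \<open>auto simp: P_def\<close>)
  \<comment> \<open>The case \<open>t = 1\<close> exhibits \<open>exp (- g z)\<close> as a power
    series; \<open>- ln\<close> of it recovers \<open>g\<close> and shows that \<open>g\<close> is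
    differentiable near 0.\<close>
  define f where "f = (\<lambda>z. exp (- g z))"
  have f: "f has_fps_expansion P 1"
    using P[of 1] by (simp add: f_def)
  have f_pos: "f z > 0" for z
    by (simp add: f_def)
  \<comment> \<open>The series of g' = - f' / f. The division makes sense because \<open>P 1\<close>
    has constant term \<open>exp (- g 0)\<close>, which is nonzero.\<close>
  define Q where "Q = - (fps_deriv (P 1) / P 1)"
  have P0: "fps_nth (P t) 0 = exp (- t * g 0)" if "t \<ge> 0" for t
    using has_fps_expansion_higher_deriv[OF P[OF that], of 0] by simp
  have Dg: "eventually (\<lambda>z. (g has_real_derivative - (deriv f z / f z)) (at z)) (nhds 0)"
    using has_fps_expansion_eventually_DERIV[OF f]
  proof eventually_elim
    case (elim z)
    have "((\<lambda>z. - ln (f z)) has_real_derivative - (deriv f z / f z)) (at z)"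
      using elim f_pos[of z] by (auto intro!: derivative_eq_intros simp: divide_inverse)
    then show ?case
      by (simp add: f_def)
  qed
  have "(\<lambda>z. - (deriv f z / f z)) has_fps_expansion Q"
    unfolding Q_def using P0[of 1] by (intro fps_expansion_intros f) simp
  then have Q: "deriv g has_fps_expansion Q"
    by (rule has_fps_expansion_eventually_cong)
      (use Dg in \<open>auto elim!: eventually_mono dest: DERIV_imp_deriv\<close>)
  \<comment> \<open>The constant term \<open>g 0\<close> of \<open>C\<close> is lost under
    \<open>fps_deriv\<close>; the base case of the induction below brings it in.\<close>
  have CQ: "fps_deriv C = Q"
  proof (rule fps_ext)
    fix j
    have "(deriv ^^ Suc j) g 0 = fact j * fps_nth Q j"
      using has_fps_expansion_higher_deriv[OF Q, of j] by (simp add: funpow_swap1)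
    then show "fps_nth (fps_deriv C) j = fps_nth Q j"
      by (simp add: C_def del: funpow.simps of_nat_Suc)
  qed
  \<comment> \<open>Both sides expand the \<open>z\<close>-derivative of
    \<open>exp (- t * g z)\<close>, by the chain rule near 0.\<close>
  have ode: "fps_deriv (P t) = fps_const (- t) * (fps_deriv C * P t)" if "t \<ge> 0" for t
  proof (rule has_fps_expansion_real_unique)
    show "deriv (\<lambda>z. exp (- t * g z)) has_fps_expansion fps_deriv (P t)"
      by (intro fps_expansion_intros P that)
    have "(\<lambda>z. (- t) * (deriv g z * exp (- t * g z))) has_fps_expansion
            fps_const (- t) * (fps_deriv C * P t)"
      unfolding CQ by (intro has_fps_expansion_cmult_left has_fps_expansion_mult Q P that)
    then show "deriv (\<lambda>z. exp (- t * g z)) has_fps_expansion fps_const (- t) * (fps_deriv C * P t)"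
    proof (rule has_fps_expansion_eventually_cong)
      show "\<forall>\<^sub>F z in nhds 0. - t * (deriv g z * exp (- t * g z)) = deriv (\<lambda>z. exp (- t * g z)) z"
        using Dg
      proof eventually_elim
        case (elim z)
        then have "(g has_real_derivative deriv g z) (at z)"
          by (simp add: DERIV_imp_deriv)
        then have "((\<lambda>z. exp (- t * g z)) has_real_derivative - t * (deriv g z * exp (- t * g z))) (at z)"
          by (auto intro!: derivative_eq_intros)
        then show ?case
          by (simp add: DERIV_imp_deriv)
      qed
    qed
  qed
  \<comment> \<open>Expresses coefficient \<open>Suc m\<close> through those up to \<open>m\<close>
    with explicit dependence on \<open>t\<close>, so strong induction can differentiate in
    \<open>t\<close>.\<close>
  have rec: "fps_nth (P t) (Suc m) = - t / real (Suc m) * (\<Sum>i=0..m. fps_nth Q i * fps_nth (P t) (m - i))"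
    if "t \<ge> 0" for t m
  proof -
    have "fps_nth (fps_deriv (P t)) m = - t * fps_nth (Q * P t) m"
      by (simp only: ode[OF that] CQ fps_mult_left_const_nth)
    then have "real (Suc m) * fps_nth (P t) (Suc m) = - t * fps_nth (Q * P t) m"
      by (simp del: of_nat_Suc)
    then show ?thesis
      unfolding fps_mult_nth[of Q] by (simp add: field_simps del: of_nat_Suc)
  qed
  have main: "((\<lambda>s. fps_nth (P s) k) has_real_derivative - fps_nth (C * P t) k) (at t within {0..})"
    if "t \<ge> 0" for t
    using that
  proof (induction k arbitrary: t rule: less_induct)
    case (less k)
    show ?case
    proof (cases k)
      case 0
      have "((\<lambda>s. exp (- s * g 0)) has_real_derivative - fps_nth (C * P t) 0) (at t within {0..})"
        using P0[OF \<open>t \<ge> 0\<close>] by (auto intro!: derivative_eq_intros simp: fps_mult_nth C_def)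
      then show ?thesis
        unfolding 0 by (rule has_field_derivative_transform_within[where d = 1])
          (use P0 \<open>t \<ge> 0\<close> in auto)
    next
      case (Suc m)
      let ?S = "\<lambda>s. \<Sum>i=0..m. fps_nth Q i * fps_nth (P s) (m - i)"
      have S: "(?S has_real_derivative (\<Sum>i=0..m. fps_nth Q i * - fps_nth (C * P t) (m - i)))
                 (at t within {0..})"
        by (intro DERIV_sum DERIV_cmult less.IH) (use Suc \<open>t \<ge> 0\<close> in auto)
      also have "(\<Sum>i=0..m. fps_nth Q i * - fps_nth (C * P t) (m - i)) = - fps_nth (Q * (C * P t)) m"
        by (simp add: fps_mult_nth[of Q "C * P t"] sum_negf)
      \<comment> \<open>Product rule for the recursion: one term from the factor
        \<open>- s / real (Suc m)\<close>, one from \<open>?S\<close>, whose derivative is the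
        induction hypothesis.\<close>
      finally have "((\<lambda>s. - s / real (Suc m) * ?S s) has_real_derivative
          - t / real (Suc m) * - fps_nth (Q * (C * P t)) m + - 1 / real (Suc m) * ?S t) (at t within {0..})"
        by (intro DERIV_mult') (auto intro!: derivative_eq_intros simp del: of_nat_Suc)
      also have "?S t = fps_nth (Q * P t) m"
        by (simp add: fps_mult_nth)
      also have "- t / real (Suc m) * - fps_nth (Q * (C * P t)) m + - 1 / real (Suc m) * fps_nth (Q * P t) m
         = - (fps_nth (Q * P t) m + - t * fps_nth (Q * (C * P t)) m) / real (Suc m)"
        by (simp add: field_simps del: of_nat_Suc)
      \<comment> \<open>By \<open>ode\<close>, \<open>- t\<close> times \<open>Q * P t\<close> is
        the \<open>z\<close>-derivative of \<open>P t\<close>. The two terms thus become C' P + C P'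
        = (C P)', whose coefficient \<open>m\<close> is \<open>Suc m\<close> times coefficient
        \<open>Suc m\<close> of \<open>C * P t\<close>.\<close>
      also have "- t * fps_nth (Q * (C * P t)) m = fps_nth (C * (fps_const (- t) * (Q * P t))) m"
        by (simp only: fps_mult_left_const_nth mult.left_commute[of C])
      also have "fps_nth (Q * P t) m + fps_nth (C * (fps_const (- t) * (Q * P t))) m
         = fps_nth (fps_deriv (C * P t)) m"
        by (simp only: fps_deriv_mult ode[OF \<open>t \<ge> 0\<close>] CQ fps_add_nth add.commute)
      also have "- fps_nth (fps_deriv (C * P t)) m / real (Suc m) = - fps_nth (C * P t) (Suc m)"
        by (simp add: fps_deriv_nth del: of_nat_Suc fps_deriv_mult)
      finally show ?thesis
        unfolding Suc by (rule has_field_derivative_transform_within[where d = 1])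
          (use rec \<open>t \<ge> 0\<close> in auto)
    qed
  qed
  show ?thesis
    using main[OF \<open>t \<ge> 0\<close>] by (simp add: P_def C_def fps_mult_nth atLeast0AtMost)
qed

subsection \<open>Random times independent of a process\<close>

text \<open>\<open>generated_sigma\<close> is a bare set of sets; carrying it as the sets of a
  measure makes \<open>measurable\<close> and \<open>subalgebra\<close> applicable.\<close>

definition process_algebra ::
    "'a measure \<Rightarrow> 'b measure \<Rightarrow> 'i set \<Rightarrow> ('i \<Rightarrow> 'a \<Rightarrow> 'b) \<Rightarrow> 'a measure" where
  "process_algebra M K I X = sigma (space M) {X i -` A \<inter> space M | i A. i \<in> I \<and> A \<in> sets K}"

lemma space_process_algebra [simp]: "space (process_algebra M K I X) = space M"
  unfolding process_algebra_def by (rule space_measure_of) auto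

lemma sets_process_algebra: "sets (process_algebra M K I X) = generated_sigma M K I X"
  unfolding process_algebra_def generated_sigma_def by (rule sets_measure_of) auto

lemma measurable_process_algebra:
  assumes "i \<in> I" "X i \<in> space M \<rightarrow> space K"
  shows "X i \<in> measurable (process_algebra M K I X) K"
  using assms by (intro measurableI) (auto simp: sets_process_algebra generated_sigma_def)

section \<open>Independence and conditioning on a countable partition\<close>

context prob_space
begin

text \<open>Preimages under \<open>X\<close> and \<open>Y\<close> lie in \<open>F\<close> and
  \<open>G\<close>, and independence passes to subfamilies. This carries independence of whole
  processes over to functionals of them.\<close>

lemma indep_var_sub_algebras:
  assumes "indep_set (sets F) (sets G)" "space F = space M" "space G = space M"
    and X: "X \<in> measurable F S" and Y: "Y \<in> measurable G T"
  shows "indep_var S X T Y"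
proof -
  have "subalgebra M F" "subalgebra M G"
    using assms(1-3) by (auto simp: subalgebra_def dest: indep_setD_ev1 indep_setD_ev2)
  have "indep_sets (case_bool {X -` A \<inter> space M | A. A \<in> sets S} {Y -` A \<inter> space M | A. A \<in> sets T}) UNIV"
    using assms(1) unfolding indep_set_def
    by (rule indep_sets_mono_sets)
      (use measurable_sets[OF X] measurable_sets[OF Y] assms(2,3) in \<open>auto split: bool.splits\<close>)
  moreover have "X \<in> measurable M S"
    by (rule measurable_from_subalg[OF \<open>subalgebra M F\<close> X])
  moreover have "Y \<in> measurable M T"
    by (rule measurable_from_subalg[OF \<open>subalgebra M G\<close> Y])
  moreover have "(\<lambda>i. {case_bool X Y i -` A \<inter> space M | A. A \<in> sets (case_bool S T i)})
      = case_bool {X -` A \<inter> space M | A. A \<in> sets S} {Y -` A \<inter> space M | A. A \<in> sets T}"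
    by (rule ext) (simp split: bool.split)
  ultimately show ?thesis
    unfolding indep_var_def indep_vars_def2 by (simp split: bool.split)
qed

text \<open>At each point at most one term of the series is nonzero. Sum and expectation may be
  exchanged because the \<open>j\<close>-th expected absolute value is at most the probability of
  \<open>D = j\<close>, and these events are disjoint.\<close>

lemma sums_expectation_partition:
  fixes U :: "nat \<Rightarrow> 'a \<Rightarrow> real"
  assumes D [measurable]: "D \<in> measurable M (count_space UNIV)"
    and U [measurable]: "\<And>j. U j \<in> borel_measurable M"
    and bound: "\<And>j \<omega>. \<omega> \<in> space M \<Longrightarrow> \<bar>U j \<omega>\<bar> \<le> 1"
  shows "(\<lambda>j. expectation (\<lambda>\<omega>. indicator {j} (D \<omega>) * U j \<omega>)) sums expectation (\<lambda>\<omega>. U (D \<omega>) \<omega>)"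
proof -
  let ?f = "\<lambda>j \<omega>. indicator {j} (D \<omega>) * U j \<omega>"
  have f_eq: "?f j \<omega> = (if j = D \<omega> then U (D \<omega>) \<omega> else 0)" for j \<omega>
    by (auto simp: indicator_def)
  have f_sums: "(\<lambda>j. ?f j \<omega>) sums U (D \<omega>) \<omega>" for \<omega>
    unfolding f_eq by (rule sums_single)
  have int: "integrable M (?f j)" for j
    by (rule integrable_const_bound[where B = 1]) (use bound in \<open>auto simp: indicator_def\<close>)
  have "(\<lambda>j. expectation (?f j)) sums expectation (\<lambda>\<omega>. \<Sum>j. ?f j \<omega>)"
  proof (rule sums_integral)
    show "AE \<omega> in M. summable (\<lambda>j. norm (?f j \<omega>))"
      unfolding f_eq by (intro AE_I2 summable_finite[of "{D _}"]) auto
    have "disjoint_family (\<lambda>j. D -` {j} \<inter> space M)"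
      by (auto simp: disjoint_family_on_def)
    then have "(\<lambda>j. prob (D -` {j} \<inter> space M)) sums prob (\<Union>j. D -` {j} \<inter> space M)"
      by (intro finite_measure_UNION) (auto intro: measurable_sets)
    then have summable: "summable (\<lambda>j. prob (D -` {j} \<inter> space M))"
      by (rule sums_summable)
    show "summable (\<lambda>j. expectation (\<lambda>\<omega>. norm (?f j \<omega>)))"
    proof (rule summable_comparison_test'[OF summable])
      fix j
      have "expectation (\<lambda>\<omega>. norm (?f j \<omega>)) \<le> expectation (indicator (D -` {j} \<inter> space M))"
      proof (rule integral_mono)
        show "integrable M (\<lambda>\<omega>. norm (?f j \<omega>))"
          by (intro integrable_norm int)
        show "integrable M (indicat_real (D -` {j} \<inter> space M))"
          by (auto simp: less_top[symmetric])
      qed (use bound in \<open>auto simp: indicator_def\<close>)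
      then show "norm (expectation (\<lambda>\<omega>. norm (?f j \<omega>))) \<le> prob (D -` {j} \<inter> space M)"
        by simp
    qed
  qed (rule int)
  then show ?thesis
    using f_sums by (simp add: sums_iff)
qed

text \<open>Conditioning on a discrete \<open>D\<close>: on each event \<open>D = j\<close>
  independence splits off the expectation of \<open>U j\<close>, and the pieces are summed
  back.\<close>

lemma expectation_indep_partition:
  fixes U :: "nat \<Rightarrow> 'a \<Rightarrow> real"
  assumes D [measurable]: "D \<in> measurable M (count_space UNIV)"
    and indep: "\<And>j. indep_var borel (U j) borel (\<lambda>\<omega>. indicat_real {j} (D \<omega>))"
    and bound: "\<And>j \<omega>. \<omega> \<in> space M \<Longrightarrow> \<bar>U j \<omega>\<bar> \<le> 1"
  shows "expectation (\<lambda>\<omega>. U (D \<omega>) \<omega>) = expectation (\<lambda>\<omega>. expectation (U (D \<omega>)))"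
proof -
  have U [measurable]: "U j \<in> borel_measurable M" for j
    using indep_var_rv1[OF indep[of j]] by simp
  have int: "integrable M (U j)" for j
    by (rule integrable_const_bound[where B = 1]) (use bound in auto)
  have le1: "\<bar>expectation (U j)\<bar> \<le> 1" for j
  proof -
    have "\<bar>expectation (U j)\<bar> \<le> expectation (\<lambda>\<omega>. \<bar>U j \<omega>\<bar>)"
      by (rule integral_abs_bound)
    also have "\<dots> \<le> expectation (\<lambda>\<omega>. 1)"
      by (rule integral_mono) (use int bound in auto)
    finally show ?thesis by (simp add: prob_space)
  qed
  have "expectation (\<lambda>\<omega>. indicator {j} (D \<omega>) * U j \<omega>)
      = expectation (\<lambda>\<omega>. indicator {j} (D \<omega>) * expectation (U j))" for j
  proof -
    have "expectation (\<lambda>\<omega>. U j \<omega> * indicator {j} (D \<omega>))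
        = expectation (U j) * expectation (\<lambda>\<omega>. indicator {j} (D \<omega>))"
      by (rule indep_var_lebesgue_integral[OF indep])
        (auto intro!: int integrable_const_bound[where B = 1] simp: indicator_def)
    then show ?thesis
      by (simp add: mult.commute)
  qed
  \<comment> \<open>The partition formula is used for \<open>U\<close> and for the constants
    \<open>expectation (U j)\<close>; both series have just been shown to have the same
    terms.\<close>
  then show ?thesis
    using sums_expectation_partition[where U = U, OF D U bound, THEN sums_unique]
      sums_expectation_partition[OF D, of "\<lambda>j _. expectation (U j)", THEN sums_unique] le1
    by simp
qed

lemma sums_prob_generating_function:
  fixes X :: "'a \<Rightarrow> nat" and z :: real
  assumes X [measurable]: "X \<in> measurable M (count_space UNIV)" and z: "\<bar>z\<bar> \<le> 1"
  shows "(\<lambda>k. prob {\<omega> \<in> space M. X \<omega> = k} * z ^ k) sums expectation (\<lambda>\<omega>. z ^ X \<omega>)"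
proof -
  have "(\<lambda>k. expectation (\<lambda>\<omega>. indicator {k} (X \<omega>) * z ^ k)) sums expectation (\<lambda>\<omega>. z ^ X \<omega>)"
    by (rule sums_expectation_partition) (use z in \<open>auto simp: power_abs intro: power_le_one\<close>)
  moreover have "expectation (\<lambda>\<omega>. indicat_real {k} (X \<omega>)) = prob {\<omega> \<in> space M. X \<omega> = k}" for k
  proof -
    have "expectation (\<lambda>\<omega>. indicat_real {k} (X \<omega>)) = expectation (indicator {\<omega> \<in> space M. X \<omega> = k})"
      by (rule Bochner_Integration.integral_cong) (auto simp: indicator_def)
    then show ?thesis by simp
  qed
  ultimately show ?thesis by simp
qed

end

text \<open>The grid has step \<open>1 / real (Suc m)\<close>. For \<open>y \<ge> 0\<close>,
  \<open>a = 0\<close> rounds \<open>y\<close> down to the grid, and \<open>a = 1\<close> gives the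
  next grid point, strictly above \<open>y\<close>.\<close>

definition time_grid :: "nat \<Rightarrow> nat \<Rightarrow> real \<Rightarrow> real" where
  "time_grid a m y = (real (nat \<lfloor>real (Suc m) * y\<rfloor>) + real a) / real (Suc m)"

lemma time_grid_bounds:
  assumes "y \<ge> 0"
  shows "y + (real a - 1) / real (Suc m) < time_grid a m y"
    and "time_grid a m y \<le> y + real a / real (Suc m)"
proof -
  define S where "S = real (Suc m)"
  have "S > 0"
    by (simp add: S_def)
  have "S * y - 1 < of_int \<lfloor>S * y\<rfloor>" "of_int \<lfloor>S * y\<rfloor> \<le> S * y"
    by linarith+
  moreover have "time_grid a m y = (of_int \<lfloor>S * y\<rfloor> + real a) / S"
    using assms by (simp add: time_grid_def S_def)
  moreover have "y + c / S = (S * y + c) / S" for c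
    using \<open>S > 0\<close> by (simp add: field_simps)
  ultimately show "y + (real a - 1) / real (Suc m) < time_grid a m y"
    "time_grid a m y \<le> y + real a / real (Suc m)"
    unfolding S_def[symmetric] using \<open>S > 0\<close> by (simp_all add: divide_less_cancel divide_le_cancel)
qed

lemma time_grid_0_le: "y \<ge> 0 \<Longrightarrow> time_grid 0 m y \<le> y"
  using time_grid_bounds(2)[of y 0 m] by simp

lemma time_grid_1_gt: "y \<ge> 0 \<Longrightarrow> y < time_grid 1 m y"
  using time_grid_bounds(1)[of y 1 m] by simp

lemma time_grid_nonneg: "time_grid a m y \<ge> 0"
  by (simp add: time_grid_def)

lemma time_grid_tendsto:
  assumes "y \<ge> 0"
  shows "(\<lambda>m. time_grid a m y) \<longlonglongrightarrow> y"
proof (rule real_tendsto_sandwich)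
  have scaled: "c / real (Suc m) = c * inverse (real (Suc m))" for c m
    by (simp add: field_simps)
  have lim: "(\<lambda>m. y + c / real (Suc m)) \<longlonglongrightarrow> y" for c
    unfolding scaled
    using tendsto_add[OF tendsto_const[of y] tendsto_mult[OF tendsto_const[of c] LIMSEQ_inverse_real_of_nat]]
    by (simp del: of_nat_Suc)
  show "(\<lambda>m. y + (real a - 1) / real (Suc m)) \<longlonglongrightarrow> y" "(\<lambda>m. y + real a / real (Suc m)) \<longlonglongrightarrow> y"
    by (rule lim)+
  show "\<forall>\<^sub>F m in sequentially. y + (real a - 1) / real (Suc m) \<le> time_grid a m y"
    "\<forall>\<^sub>F m in sequentially. time_grid a m y \<le> y + real a / real (Suc m)"
    by (intro always_eventually allI less_imp_le time_grid_bounds assms)+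
qed

section \<open>Conditioning on an independent clock\<close>

context prob_space
begin

text \<open>Only countably many grid times occur, so measurability of each \<open>X s\<close>
  separately is enough.\<close>

lemma measurable_time_grid:
  fixes X :: "real \<Rightarrow> 'a \<Rightarrow> 'b" and Y :: "'a \<Rightarrow> real"
  assumes X: "\<And>s. s \<ge> 0 \<Longrightarrow> X s \<in> measurable M K" and Y [measurable]: "Y \<in> borel_measurable M"
  shows "(\<lambda>\<omega>. X (time_grid a m (Y \<omega>)) \<omega>) \<in> measurable M K"
proof -
  have "X ((real j + real a) / real (Suc m)) \<in> measurable M K" for j
    by (rule X) simp
  moreover have "(\<lambda>\<omega>. nat \<lfloor>real (Suc m) * Y \<omega>\<rfloor>) \<in> measurable M (count_space UNIV)"
    by measurable
  ultimately show ?thesis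
    unfolding time_grid_def by (rule measurable_compose_countable)
qed

text \<open>For fixed \<open>m\<close> the clock is discrete and independent of \<open>X\<close>, so
  \<open>X s\<close> may be replaced by its expectation \<open>exp (- c * s)\<close>; the limit in
  \<open>m\<close> is dominated convergence. \<open>F\<close> carries \<open>X\<close> and
  \<open>G\<close> carries \<open>Y\<close>.\<close>

lemma expectation_time_grid_tendsto:
  fixes X :: "real \<Rightarrow> 'a \<Rightarrow> real" and Y :: "'a \<Rightarrow> real"
  assumes indep: "indep_set (sets F) (sets G)" and spaces: "space F = space M" "space G = space M"
    and X: "\<And>s. s \<ge> 0 \<Longrightarrow> X s \<in> borel_measurable F"
    and Y: "Y \<in> borel_measurable G"
    and Y_nonneg: "\<And>\<omega>. \<omega> \<in> space M \<Longrightarrow> Y \<omega> \<ge> 0"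
    and bound: "\<And>s \<omega>. s \<ge> 0 \<Longrightarrow> \<omega> \<in> space M \<Longrightarrow> \<bar>X s \<omega>\<bar> \<le> 1"
    and expX: "\<And>s. s \<ge> 0 \<Longrightarrow> expectation (X s) = exp (- c * s)"
    and "c \<ge> 0"
  shows "(\<lambda>m. expectation (\<lambda>\<omega>. X (time_grid a m (Y \<omega>)) \<omega>)) \<longlonglongrightarrow> expectation (\<lambda>\<omega>. exp (- c * Y \<omega>))"
proof -
  have Y_M [measurable]: "Y \<in> borel_measurable M"
    using indep_setD_ev2[OF indep] spaces by (intro measurable_from_subalg[OF _ Y]) (simp add: subalgebra_def)
  have eq: "expectation (\<lambda>\<omega>. X (time_grid a m (Y \<omega>)) \<omega>) = expectation (\<lambda>\<omega>. exp (- c * time_grid a m (Y \<omega>)))"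
    for m
  proof -
    \<comment> \<open>\<open>D\<close> numbers the grid cell containing \<open>Y\<close>, and
      \<open>U j\<close> is \<open>X\<close> at the grid point attached to cell
      \<open>j\<close>.\<close>
    define D where "D \<omega> = nat \<lfloor>real (Suc m) * Y \<omega>\<rfloor>" for \<omega>
    define U where "U j = X ((real j + real a) / real (Suc m))" for j
    note Y [measurable]
    have D_G [measurable]: "D \<in> measurable G (count_space UNIV)"
      unfolding D_def by measurable
    have D_M: "D \<in> measurable M (count_space UNIV)"
      unfolding D_def by measurable
    have "(\<lambda>\<omega>. indicat_real {j} (D \<omega>)) \<in> borel_measurable G" for j
      by (rule measurable_compose[OF D_G]) simp
    then have "indep_var borel (U j) borel (\<lambda>\<omega>. indicat_real {j} (D \<omega>))" for j
      unfolding U_def by (intro indep_var_sub_algebras[OF indep spaces] X) auto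
    then have "expectation (\<lambda>\<omega>. U (D \<omega>) \<omega>) = expectation (\<lambda>\<omega>. expectation (U (D \<omega>)))"
      by (rule expectation_indep_partition[OF D_M]) (auto simp: U_def intro!: bound)
    then show ?thesis
      by (simp add: U_def D_def time_grid_def expX)
  qed
  show ?thesis
    unfolding eq
  proof (rule integral_dominated_convergence[where w = "\<lambda>_. 1"])
    show "(\<lambda>\<omega>. exp (- c * time_grid a m (Y \<omega>))) \<in> borel_measurable M" for m
      unfolding time_grid_def by measurable
    show "AE \<omega> in M. (\<lambda>m. exp (- c * time_grid a m (Y \<omega>))) \<longlonglongrightarrow> exp (- c * Y \<omega>)"
      by (intro AE_I2 tendsto_intros time_grid_tendsto Y_nonneg)
    show "AE \<omega> in M. norm (exp (- c * time_grid a m (Y \<omega>))) \<le> 1" for m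
      using \<open>c \<ge> 0\<close> by (simp add: time_grid_nonneg)
  qed auto
qed

text \<open>
  Composing with a merely monotone \<open>X\<close> need not be jointly measurable, so the expectation is
  squeezed between the two grid approximations of the random time.
\<close>

lemma expectation_antimono_time_change:
  fixes X :: "real \<Rightarrow> 'a \<Rightarrow> real" and Y :: "'a \<Rightarrow> real"
  assumes indep: "indep_set (sets F) (sets G)" and spaces: "space F = space M" "space G = space M"
    and X: "\<And>s. s \<ge> 0 \<Longrightarrow> X s \<in> borel_measurable F"
    and Y: "Y \<in> borel_measurable G"
    and Y_nonneg: "\<And>\<omega>. \<omega> \<in> space M \<Longrightarrow> Y \<omega> \<ge> 0"
    and bound: "\<And>s \<omega>. s \<ge> 0 \<Longrightarrow> \<omega> \<in> space M \<Longrightarrow> \<bar>X s \<omega>\<bar> \<le> 1"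
    and expX: "\<And>s. s \<ge> 0 \<Longrightarrow> expectation (X s) = exp (- c * s)"
    and "c \<ge> 0"
    and anti: "\<And>s t \<omega>. 0 \<le> s \<Longrightarrow> s \<le> t \<Longrightarrow> \<omega> \<in> space M \<Longrightarrow> X t \<omega> \<le> X s \<omega>"
    and meas: "(\<lambda>\<omega>. X (Y \<omega>) \<omega>) \<in> borel_measurable M"
  shows "expectation (\<lambda>\<omega>. X (Y \<omega>) \<omega>) = expectation (\<lambda>\<omega>. exp (- c * Y \<omega>))"
proof (rule antisym)
  have lim: "(\<lambda>m. expectation (\<lambda>\<omega>. X (time_grid a m (Y \<omega>)) \<omega>)) \<longlonglongrightarrow> expectation (\<lambda>\<omega>. exp (- c * Y \<omega>))" for a
    using indep spaces
    by (rule expectation_time_grid_tendsto[where F = F and G = G]) (fact X Y Y_nonneg bound expX \<open>c \<ge> 0\<close>)+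
  have F: "subalgebra M F" and G: "subalgebra M G"
    using indep_setD_ev1[OF indep] indep_setD_ev2[OF indep] spaces by (auto simp: subalgebra_def)
  have grid_int: "integrable M (\<lambda>\<omega>. X (time_grid a m (Y \<omega>)) \<omega>)" for a m
  proof (rule integrable_const_bound[where B = 1])
    show "(\<lambda>\<omega>. X (time_grid a m (Y \<omega>)) \<omega>) \<in> borel_measurable M"
      by (rule measurable_time_grid[where X = X and Y = Y, OF measurable_from_subalg[OF F X] measurable_from_subalg[OF G Y]])
    show "AE \<omega> in M. norm (X (time_grid a m (Y \<omega>)) \<omega>) \<le> 1"
      by (rule AE_I2) (simp add: bound time_grid_nonneg)
  qed
  have int: "integrable M (\<lambda>\<omega>. X (Y \<omega>) \<omega>)"
    by (rule integrable_const_bound[where B = 1]) (auto intro!: meas bound Y_nonneg)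
  \<comment> \<open>As \<open>X\<close> decreases in time, evaluating it at or before
    \<open>Y\<close> (\<open>a = 0\<close>) bounds from above, and after \<open>Y\<close>
    (\<open>a = 1\<close>) from below.\<close>
  show "expectation (\<lambda>\<omega>. X (Y \<omega>) \<omega>) \<le> expectation (\<lambda>\<omega>. exp (- c * Y \<omega>))"
  proof (rule LIMSEQ_le_const[OF lim[of 0]], intro exI[of _ 0] allI impI)
    show "expectation (\<lambda>\<omega>. X (Y \<omega>) \<omega>) \<le> expectation (\<lambda>\<omega>. X (time_grid 0 m (Y \<omega>)) \<omega>)" for m
      by (rule integral_mono[OF int grid_int]) (intro anti time_grid_nonneg time_grid_0_le Y_nonneg)
  qed
  show "expectation (\<lambda>\<omega>. exp (- c * Y \<omega>)) \<le> expectation (\<lambda>\<omega>. X (Y \<omega>) \<omega>)"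
  proof (rule LIMSEQ_le_const2[OF lim[of 1]], intro exI[of _ 0] allI impI)
    show "expectation (\<lambda>\<omega>. X (time_grid 1 m (Y \<omega>)) \<omega>) \<le> expectation (\<lambda>\<omega>. X (Y \<omega>) \<omega>)" for m
      by (rule integral_mono[OF grid_int int]) (intro anti less_imp_le time_grid_1_gt Y_nonneg)
  qed
qed

end

text \<open>Since \<open>nat\<close> is discrete, right-continuity at \<open>y\<close> means being
  constant just to the right of \<open>y\<close>; \<open>a = 1\<close> keeps the grid points
  strictly there.\<close>

lemma right_continuous_time_grid:
  fixes f :: "real \<Rightarrow> nat"
  assumes "y \<ge> 0" "continuous (at_right y) f"
  shows "eventually (\<lambda>m. f (time_grid 1 m y) = f y) sequentially"
proof -
  have "eventually (\<lambda>s. f s = f y) (at_right y)"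
    using assms(2) by (simp add: continuous_within nhds_discrete filterlim_principal)
  moreover have "filterlim (\<lambda>m. time_grid 1 m y) (at_right y) sequentially"
    unfolding filterlim_at using time_grid_tendsto[OF assms(1)] time_grid_1_gt[OF assms(1)]
    by (auto simp del: One_nat_def intro!: always_eventually less_imp_neq[symmetric])
  ultimately show ?thesis
    by (auto simp: filterlim_iff)
qed

subsection \<open>The subordinated Poisson process\<close>

context prob_space
begin

text \<open>For negative \<open>z\<close> the power \<open>z ^ N s \<omega>\<close> is not monotone
  in \<open>s\<close>, so right-continuity replaces the squeeze: at each point the grid values with
  \<open>a = 1\<close> are eventually equal to the composed value. This gives measurability and, by
  dominated convergence, the expectation.\<close>

lemma expectation_right_continuous_time_change:
  fixes N :: "real \<Rightarrow> 'a \<Rightarrow> nat" and Y :: "'a \<Rightarrow> real"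
  assumes indep: "indep_set (sets F) (sets G)" and spaces: "space F = space M" "space G = space M"
    and N: "\<And>s. s \<ge> 0 \<Longrightarrow> N s \<in> measurable F (count_space UNIV)"
    and Y: "Y \<in> borel_measurable G"
    and Y_nonneg: "\<And>\<omega>. \<omega> \<in> space M \<Longrightarrow> Y \<omega> \<ge> 0"
    and right_cont: "\<And>\<omega> s. \<omega> \<in> space M \<Longrightarrow> s \<ge> 0 \<Longrightarrow> continuous (at_right s) (\<lambda>s. N s \<omega>)"
  shows measurable_right_continuous_time_change:
      "(\<lambda>\<omega>. N (Y \<omega>) \<omega>) \<in> measurable M (count_space UNIV)"
    and "\<lbrakk>\<bar>z\<bar> \<le> 1; c \<ge> 0; \<And>s. s \<ge> 0 \<Longrightarrow> expectation (\<lambda>\<omega>. z ^ N s \<omega>) = exp (- c * s)\<rbrakk>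
      \<Longrightarrow> expectation (\<lambda>\<omega>. z ^ N (Y \<omega>) \<omega>) = expectation (\<lambda>\<omega>. exp (- c * Y \<omega>))"
proof -
  have F: "subalgebra M F" and G: "subalgebra M G"
    using indep_setD_ev1[OF indep] indep_setD_ev2[OF indep] spaces by (auto simp: subalgebra_def)
  have N_M: "N s \<in> measurable M (count_space UNIV)" if "s \<ge> 0" for s
    by (rule measurable_from_subalg[OF F N[OF that]])
  have Y_M: "Y \<in> borel_measurable M"
    by (rule measurable_from_subalg[OF G Y])
  have grid [measurable]: "(\<lambda>\<omega>. N (time_grid 1 m (Y \<omega>)) \<omega>) \<in> measurable M (count_space UNIV)" for m
    by (rule measurable_time_grid[where X = N and Y = Y, OF N_M Y_M])
  have lim: "(\<lambda>m. h (N (time_grid 1 m (Y \<omega>)) \<omega>)) \<longlonglongrightarrow> h (N (Y \<omega>) \<omega>)"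
    if "\<omega> \<in> space M" for \<omega> and h :: "nat \<Rightarrow> real"
    using right_continuous_time_grid[OF Y_nonneg[OF that], of "\<lambda>s. N s \<omega>"]
      right_cont[OF that Y_nonneg[OF that]]
    by (intro tendsto_eventually) (auto elim: eventually_mono)
  \<comment> \<open>Read in the reals, the composition is a pointwise limit of measurable functions;
    its level sets then give measurability into \<open>nat\<close>.\<close>
  have "(\<lambda>\<omega>. real (N (Y \<omega>) \<omega>)) \<in> borel_measurable M"
    by (rule borel_measurable_LIMSEQ_real[OF lim]) measurable
  then have "{\<omega> \<in> space M. real (N (Y \<omega>) \<omega>) = real k} \<in> events" for k
    by measurable
  then have "(\<lambda>\<omega>. N (Y \<omega>) \<omega>) -` {k} \<inter> space M \<in> events" for k
    by (simp add: vimage_def Int_def conj_commute)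
  then show meas [measurable]: "(\<lambda>\<omega>. N (Y \<omega>) \<omega>) \<in> measurable M (count_space UNIV)"
    by (simp add: measurable_count_space_eq2_countable)
  assume z: "\<bar>z\<bar> \<le> 1" and "c \<ge> 0"
    and expN: "\<And>s. s \<ge> 0 \<Longrightarrow> expectation (\<lambda>\<omega>. z ^ N s \<omega>) = exp (- c * s)"
  have z_le: "\<bar>z ^ k\<bar> \<le> 1" for k :: nat
    using z by (simp add: power_abs power_le_one)
  have "(\<lambda>m. expectation (\<lambda>\<omega>. z ^ N (time_grid 1 m (Y \<omega>)) \<omega>)) \<longlonglongrightarrow> expectation (\<lambda>\<omega>. z ^ N (Y \<omega>) \<omega>)"
    by (rule integral_dominated_convergence[where w = "\<lambda>_. 1"]) (auto intro!: lim simp: z_le simp del: One_nat_def)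
  moreover have "(\<lambda>m. expectation (\<lambda>\<omega>. z ^ N (time_grid 1 m (Y \<omega>)) \<omega>))
      \<longlonglongrightarrow> expectation (\<lambda>\<omega>. exp (- c * Y \<omega>))"
  proof (rule expectation_time_grid_tendsto[where X = "\<lambda>s \<omega>. z ^ N s \<omega>", OF indep spaces _ Y Y_nonneg _ expN \<open>c \<ge> 0\<close>])
    show "(\<lambda>\<omega>. z ^ N s \<omega>) \<in> borel_measurable F" if "s \<ge> 0" for s
      by (rule measurable_compose[OF N[OF that]]) simp
  qed (auto simp: z_le)
  ultimately show "expectation (\<lambda>\<omega>. z ^ N (Y \<omega>) \<omega>) = expectation (\<lambda>\<omega>. exp (- c * Y \<omega>))"
    by (rule LIMSEQ_unique)
qed

lemma poisson_process_generating_function: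
  assumes N: "poisson_process M rate N" and "rate > 0" "s \<ge> 0" "\<bar>z\<bar> \<le> 1"
  shows "expectation (\<lambda>\<omega>. z ^ N s \<omega>) = exp (- (rate * (1 - z)) * s)"
\<comment> \<open>The Poisson law of increments is prescribed only for strictly ordered times, so
  time 0 is settled by \<open>N 0 = 0\<close>.\<close>
proof (cases "s = 0")
  case True
  have "expectation (\<lambda>\<omega>. z ^ N s \<omega>) = expectation (\<lambda>\<omega>. 1)"
    using N True by (intro Bochner_Integration.integral_cong) (auto simp: poisson_process_def)
  then show ?thesis
    using True by (simp add: prob_space)
next
  case False
  then have "s > 0"
    using \<open>s \<ge> 0\<close> by simp
  have meas: "N s \<in> measurable M (count_space UNIV)"
    using N \<open>s \<ge> 0\<close> by (simp add: poisson_process_def)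
  have "distr M (count_space UNIV) (N s) = distr M (count_space UNIV) (\<lambda>\<omega>. N s \<omega> - N 0 \<omega>)"
    using N by (intro distr_cong) (auto simp: poisson_process_def)
  also have "\<dots> = measure_pmf (poisson_pmf (rate * (s - 0)))"
    using N \<open>s > 0\<close> unfolding poisson_process_def by blast
  finally have distr: "distr M (count_space UNIV) (N s) = measure_pmf (poisson_pmf (rate * s))"
    by simp
  have "prob {\<omega> \<in> space M. N s \<omega> = k} = (rate * s) ^ k / fact k * exp (- (rate * s))" for k
  proof -
    have "prob {\<omega> \<in> space M. N s \<omega> = k} = prob (N s -` {k} \<inter> space M)"
      by (intro arg_cong[where f = prob]) auto
    also have "\<dots> = measure (distr M (count_space UNIV) (N s)) {k}"
      by (rule measure_distr[symmetric]) (use meas in auto)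
    finally show ?thesis
      using \<open>rate > 0\<close> \<open>s > 0\<close> by (simp add: distr measure_pmf_single)
  qed
  then have "(\<lambda>k. (rate * s) ^ k / fact k * exp (- (rate * s)) * z ^ k) sums expectation (\<lambda>\<omega>. z ^ N s \<omega>)"
    using sums_prob_generating_function[OF meas \<open>\<bar>z\<bar> \<le> 1\<close>] by simp
  moreover have "(\<lambda>k. (rate * s) ^ k / fact k * exp (- (rate * s)) * z ^ k)
      sums (exp (- (rate * s)) * exp (rate * s * z))"
    using sums_mult[OF exp_converges[of "rate * s * z"], of "exp (- (rate * s))"]
    by (simp add: divide_inverse power_mult_distrib mult_ac)
  ultimately have "expectation (\<lambda>\<omega>. z ^ N s \<omega>) = exp (- (rate * s)) * exp (rate * s * z)"
    by (rule sums_unique2)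
  then show ?thesis
    by (simp add: algebra_simps flip: exp_add)
qed

section \<open>Laplace transforms of the mixture and of the clock\<close>

lemma subordinator_nonneg:
  assumes "subordinator M S" "t \<ge> 0" "\<omega> \<in> space M"
  shows "S t \<omega> \<ge> 0"
proof -
  have "mono_on {0..} (\<lambda>t. S t \<omega>)" "S 0 \<omega> = 0"
    using assms by (auto simp: subordinator_def)
  then show ?thesis
    using mono_onD[of "{0..}" "\<lambda>t. S t \<omega>" 0 t] \<open>t \<ge> 0\<close> by simp
qed

text \<open>Scaling a \<beta>-stable subordinator by \<open>a\<close> multiplies its exponent by
  \<open>a powr \<beta>\<close>, which undoes the root in the weights when \<beta> is
  \<open>\<nu> * real r\<close>. By independence the exponents add up to the binomial expansion of
  \<open>(\<eta> + \<mu> powr \<nu>) ^ n\<close> without its term at \<open>r = 0\<close>.\<close>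

lemma stable_mixture_laplace:
  assumes stable: "\<And>r. r \<in> {1..n} \<Longrightarrow> stable_subordinator M (\<nu> * real r) (V r)"
    and indep: "indep_sets (\<lambda>r. generated_sigma M borel {0..} (V r)) {1..n}"
    and "\<eta> > 0" "\<nu> > 0" "\<mu> \<ge> 0" "t \<ge> 0"
  shows "expectation (\<lambda>\<omega>. exp (- \<mu> * stable_mixture \<eta> \<nu> n V t \<omega>))
    = exp (- ((\<eta> + \<mu> powr \<nu>) ^ n - \<eta> ^ n) * t)"
proof -
  define a where "a r = real (n choose r) powr (1 / (\<nu> * real r)) * \<eta> powr (real (n - r) / (\<nu> * real r))" for r
  have a_nonneg: "a r \<ge> 0" for r
    by (simp add: a_def)
  have a_powr: "a r powr (\<nu> * real r) = real (n choose r) * \<eta> ^ (n - r)" if "r \<in> {1..n}" for r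
    using that \<open>\<nu> > 0\<close> \<open>\<eta> > 0\<close>
    by (simp add: a_def powr_mult powr_powr powr_realpow del: of_nat_diff)
  have V: "V r t \<in> borel_measurable M" "\<omega> \<in> space M \<Longrightarrow> V r t \<omega> \<ge> 0" if "r \<in> {1..n}" for r \<omega>
  proof -
    have "subordinator M (V r)"
      using stable[OF that] by (simp add: stable_subordinator_def)
    then show "V r t \<in> borel_measurable M" "\<omega> \<in> space M \<Longrightarrow> V r t \<omega> \<ge> 0"
      using \<open>t \<ge> 0\<close> by (simp_all add: subordinator_nonneg) (simp add: subordinator_def)
  qed
  have "indep_vars (\<lambda>_. borel) (\<lambda>r. V r t) {1..n}"
    unfolding indep_vars_def2
  proof (intro conjI ballI)
    show "indep_sets (\<lambda>r. {V r t -` A \<inter> space M |A. A \<in> sets borel}) {1..n}"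
      by (rule indep_sets_mono_sets[OF indep]) (use \<open>t \<ge> 0\<close> in \<open>auto simp: generated_sigma_def\<close>)
  qed (rule V)
  then have "indep_vars (\<lambda>_. borel) (\<lambda>r \<omega>. exp (- (\<mu> * a r) * V r t \<omega>)) {1..n}"
    by (rule indep_vars_compose2) measurable
  then have "expectation (\<lambda>\<omega>. \<Prod>r\<in>{1..n}. exp (- (\<mu> * a r) * V r t \<omega>))
      = (\<Prod>r\<in>{1..n}. expectation (\<lambda>\<omega>. exp (- (\<mu> * a r) * V r t \<omega>)))"
  proof (rule indep_vars_lebesgue_integral[OF finite_atLeastAtMost])
    fix r assume r: "r \<in> {1..n}"
    note [measurable] = V(1)[OF r]
    show "integrable M (\<lambda>\<omega>. exp (- (\<mu> * a r) * V r t \<omega>))"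
      by (rule integrable_const_bound[where B = 1]) (simp_all add: V(2)[OF r] a_nonneg \<open>\<mu> \<ge> 0\<close>)
  qed
  also have "\<dots> = (\<Prod>r\<in>{1..n}. exp (- t * (real (n choose r) * \<eta> ^ (n - r) * (\<mu> powr \<nu>) ^ r)))"
  proof (rule prod.cong[OF refl])
    fix r assume r: "r \<in> {1..n}"
    have "has_laplace_exponent M (V r) (\<lambda>\<mu>. \<mu> powr (\<nu> * real r))"
      using stable[OF r] by (simp add: stable_subordinator_def)
    then have "expectation (\<lambda>\<omega>. exp (- (\<mu> * a r) * V r t \<omega>)) = exp (- t * (\<mu> * a r) powr (\<nu> * real r))"
      unfolding has_laplace_exponent_def using \<open>t \<ge> 0\<close> \<open>\<mu> \<ge> 0\<close> a_nonneg[of r] by simp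
    \<comment> \<open>At \<open>\<mu> = 0\<close> both sides vanish: \<open>0 powr x = 0\<close>,
      and \<open>r \<ge> 1\<close> makes the power on the right zero.\<close>
    also have "(\<mu> * a r) powr (\<nu> * real r) = real (n choose r) * \<eta> ^ (n - r) * (\<mu> powr \<nu>) ^ r"
      using r \<open>\<mu> \<ge> 0\<close> a_nonneg[of r] a_powr[OF r]
      by (cases "\<mu> = 0") (simp_all add: powr_mult powr_powr powr_power mult.commute[of "real r"])
    finally show "expectation (\<lambda>\<omega>. exp (- (\<mu> * a r) * V r t \<omega>))
        = exp (- t * (real (n choose r) * \<eta> ^ (n - r) * (\<mu> powr \<nu>) ^ r))" .
  qed
  also have "\<dots> = exp (- t * (\<Sum>r=1..n. real (n choose r) * \<eta> ^ (n - r) * (\<mu> powr \<nu>) ^ r))"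
    by (simp add: exp_sum[symmetric] sum_distrib_left)
  also have "(\<Sum>r=1..n. real (n choose r) * \<eta> ^ (n - r) * (\<mu> powr \<nu>) ^ r) = (\<eta> + \<mu> powr \<nu>) ^ n - \<eta> ^ n"
  proof -
    have "(\<eta> + \<mu> powr \<nu>) ^ n = (\<Sum>r\<le>n. real (n choose r) * \<eta> ^ (n - r) * (\<mu> powr \<nu>) ^ r)"
      by (simp add: binomial_ring[of "\<mu> powr \<nu>" \<eta>] add.commute[of \<eta>] mult_ac)
    also have "{..n} = insert 0 {1..n}"
      by auto
    finally show ?thesis
      by simp
  qed
  also have "(\<lambda>\<omega>. \<Prod>r\<in>{1..n}. exp (- (\<mu> * a r) * V r t \<omega>))
      = (\<lambda>\<omega>. exp (- \<mu> * stable_mixture \<eta> \<nu> n V t \<omega>))"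
    by (simp add: exp_sum[symmetric] stable_mixture_def a_def sum_distrib_left sum_negf mult_ac)
  finally show ?thesis
    by (simp add: algebra_simps)
qed

lemma stable_mixture_mono:
  assumes stable: "\<And>r. r \<in> {1..n} \<Longrightarrow> stable_subordinator M (\<nu> * real r) (V r)"
    and "0 \<le> s" "s \<le> t" "\<omega> \<in> space M"
  shows "stable_mixture \<eta> \<nu> n V s \<omega> \<le> stable_mixture \<eta> \<nu> n V t \<omega>"
  unfolding stable_mixture_def
proof (intro sum_mono mult_left_mono)
  fix r assume "r \<in> {1..n}"
  then have "mono_on {0..} (\<lambda>t. V r t \<omega>)"
    using stable assms(4) by (simp add: stable_subordinator_def subordinator_def)
  then show "V r s \<omega> \<le> V r t \<omega>"
    by (rule mono_onD) (use assms(2,3) in auto)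
qed simp

lemma stable_mixture_0:
  assumes "\<And>r. r \<in> {1..n} \<Longrightarrow> stable_subordinator M (\<nu> * real r) (V r)" "\<omega> \<in> space M"
  shows "stable_mixture \<eta> \<nu> n V 0 \<omega> = 0"
  unfolding stable_mixture_def
  using assms by (intro sum.neutral) (simp add: stable_subordinator_def subordinator_def)

end

lemma (in prob_space) indep_set_commute:
  "indep_set A B \<Longrightarrow> indep_set B A"
  unfolding indep_sets2_eq by (metis Int_commute mult.commute)

text \<open>Conditioning on \<open>W t\<close> inserts the exponent \<psi> of the mixture into that
  of \<open>W\<close>. There \<open>\<eta> ^ n\<close> cancels against the
  \<open>- \<eta> ^ n\<close> in \<psi>, and the power \<open>\<delta> / real n\<close> turns the
  exponent \<open>n\<close> into \<delta>.\<close>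

lemma (in prob_space) subordinated_mixture_laplace:
  assumes "\<eta> > 0" "\<nu> > 0" "n > 0" "\<mu> \<ge> 0" "t \<ge> 0"
    and stable: "\<And>r. r \<in> {1..n} \<Longrightarrow> stable_subordinator M (\<nu> * real r) (V r)"
    and indep_V: "indep_sets (\<lambda>r. generated_sigma M borel {0..} (V r)) {1..n}"
    and W: "subordinator M W"
    and W_laplace: "has_laplace_exponent M W (\<lambda>\<mu>. (\<eta> ^ n + \<mu>) powr (\<delta> / real n) - \<eta> powr \<delta>)"
    and indep_WV: "indep_set (generated_sigma M borel {0..} W)
        (generated_sigma M borel ({1..n} \<times> {0..}) (\<lambda>(r, t). V r t))"
    and meas: "time_change (stable_mixture \<eta> \<nu> n V) W t \<in> borel_measurable M"
  shows "expectation (\<lambda>\<omega>. exp (- \<mu> * time_change (stable_mixture \<eta> \<nu> n V) W t \<omega>))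
    = exp (- t * ((\<eta> + \<mu> powr \<nu>) powr \<delta> - \<eta> powr \<delta>))"
proof -
  define mix where "mix = stable_mixture \<eta> \<nu> n V"
  define \<psi> where "\<psi> = (\<eta> + \<mu> powr \<nu>) ^ n - \<eta> ^ n"
  let ?F = "process_algebra M borel ({1..n} \<times> {0..}) (\<lambda>(r, t). V r t)"
  let ?G = "process_algebra M borel {0..} W"
  \<comment> \<open>Serves twice: \<psi> is the rate \<open>c\<close> in the time change and then an
    argument of the Laplace exponent of \<open>W\<close>.\<close>
  have \<psi>: "\<psi> \<ge> 0"
    using \<open>\<eta> > 0\<close> by (simp add: \<psi>_def power_mono)
  have W_nonneg: "W t \<omega> \<ge> 0" if "\<omega> \<in> space M" for \<omega>
    using subordinator_nonneg[OF W \<open>t \<ge> 0\<close> that] .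
  have mix_nonneg: "mix s \<omega> \<ge> 0" if "s \<ge> 0" "\<omega> \<in> space M" for s \<omega>
    using stable_mixture_mono[OF stable order_refl that, where \<eta> = \<eta>] stable_mixture_0[OF stable that(2), where \<eta> = \<eta>]
    by (simp add: mix_def)
  have "expectation (\<lambda>\<omega>. exp (- \<mu> * mix (W t \<omega>) \<omega>)) = expectation (\<lambda>\<omega>. exp (- \<psi> * W t \<omega>))"
  proof (rule expectation_antimono_time_change[where X = "\<lambda>s \<omega>. exp (- \<mu> * mix s \<omega>)" and F = ?F and G = ?G])
    show "indep_set (sets ?F) (sets ?G)"
      using indep_set_commute[OF indep_WV] by (simp add: sets_process_algebra)
    show "(\<lambda>\<omega>. exp (- \<mu> * mix s \<omega>)) \<in> borel_measurable ?F" if "s \<ge> 0" for s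
    proof -
      have "V r s \<in> borel_measurable ?F" if "r \<in> {1..n}" for r
        using measurable_process_algebra[of "(r, s)" "{1..n} \<times> {0..}" "\<lambda>(r, t). V r t" M borel]
          that \<open>s \<ge> 0\<close> by simp
      then have "mix s \<in> borel_measurable ?F"
        unfolding mix_def stable_mixture_def[abs_def] by (intro borel_measurable_sum borel_measurable_times) auto
      then show ?thesis
        by measurable
    qed
    show "W t \<in> borel_measurable ?G"
      using \<open>t \<ge> 0\<close> by (intro measurable_process_algebra) auto
    show "\<bar>exp (- \<mu> * mix s \<omega>)\<bar> \<le> 1" if "s \<ge> 0" "\<omega> \<in> space M" for s \<omega>
      using mix_nonneg[OF that] \<open>\<mu> \<ge> 0\<close> by simp
    show "expectation (\<lambda>\<omega>. exp (- \<mu> * mix s \<omega>)) = exp (- \<psi> * s)" if "s \<ge> 0" for s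
      unfolding mix_def \<psi>_def
      by (rule stable_mixture_laplace[OF stable indep_V \<open>\<eta> > 0\<close> \<open>\<nu> > 0\<close> \<open>\<mu> \<ge> 0\<close> that])
    show "exp (- \<mu> * mix u \<omega>) \<le> exp (- \<mu> * mix s \<omega>)" if "0 \<le> s" "s \<le> u" "\<omega> \<in> space M" for s u \<omega>
      using stable_mixture_mono[OF stable that, where \<eta> = \<eta>] \<open>\<mu> \<ge> 0\<close> by (simp add: mix_def mult_left_mono)
    show "(\<lambda>\<omega>. exp (- \<mu> * mix (W t \<omega>) \<omega>)) \<in> borel_measurable M"
      using meas unfolding mix_def time_change_def[abs_def] by measurable
  qed (simp_all add: \<psi> W_nonneg)
  also have "\<dots> = exp (- t * ((\<eta> ^ n + \<psi>) powr (\<delta> / real n) - \<eta> powr \<delta>))"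
    using W_laplace \<open>t \<ge> 0\<close> \<psi> unfolding has_laplace_exponent_def by blast
  \<comment> \<open>Positivity of \<open>\<eta> + \<mu> powr \<nu>\<close> lets its
    \<open>n\<close>-th power be read as \<open>powr\<close>.\<close>
  also have "(\<eta> ^ n + \<psi>) powr (\<delta> / real n) = (\<eta> + \<mu> powr \<nu>) powr \<delta>"
    using \<open>\<eta> > 0\<close> \<open>n > 0\<close> by (simp add: \<psi>_def powr_powr add_pos_nonneg flip: powr_realpow)
  finally show ?thesis
    by (simp add: mix_def time_change_def)
qed

theorem theorem3p1:
  fixes M :: "'a measure"
    and \<delta> \<eta> lam \<nu> :: real
    and n :: nat
    and V :: "nat \<Rightarrow> real \<Rightarrow> 'a \<Rightarrow> real"
    and W :: "real \<Rightarrow> 'a \<Rightarrow> real"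
    and N :: "real \<Rightarrow> 'a \<Rightarrow> nat"
  assumes "prob_space M"
    and "\<delta> > 0" and "\<eta> > 0" and "lam > 0" and "int n = \<lceil>\<delta>\<rceil>"
    and "\<nu> > 0" and "0 < \<nu> * real n" and "\<nu> * real n < 1"
    and "\<And>r. r \<in> {1..n} \<Longrightarrow> stable_subordinator M (\<nu> * real r) (V r)"
    and "prob_space.indep_sets M (\<lambda>r. generated_sigma M borel {0..} (V r)) {1..n}"
    and "subordinator M W"
    and "has_laplace_exponent M W
           (\<lambda>\<mu>. (\<eta> ^ n + \<mu>) powr (\<delta> / real n) - \<eta> powr \<delta>)"
    and "prob_space.indep_set M
           (generated_sigma M borel {0..} W)
           (generated_sigma M borel ({1..n} \<times> {0..}) (\<lambda>(r, t). V r t))"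
    and "poisson_process M lam N"
    and "prob_space.indep_set M
           (generated_sigma M (count_space UNIV) {0..} N)
           (generated_sigma M borel {0..} (time_change (stable_mixture \<eta> \<nu> n V) W))"
  shows "(\<forall>k. \<forall>t\<ge>0.
            (state_prob M (time_change N (time_change (stable_mixture \<eta> \<nu> n V) W)) k
              has_real_derivative
              - backshift_series (\<lambda>z. (\<eta> + lam powr \<nu> * (1 - z) powr \<nu>) powr \<delta> - \<eta> powr \<delta>)
                  (\<lambda>i. state_prob M (time_change N (time_change (stable_mixture \<eta> \<nu> n V) W)) i t) k)
            (at t within {0..})) \<and>
         (\<forall>k. state_prob M (time_change N (time_change (stable_mixture \<eta> \<nu> n V) W)) k 0 =
            (if k = 0 then 1 else 0))"
proof -
  interpret prob_space M by fact
  note stable = assms(9) and W = assms(11) and indep_NT = assms(15)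
  define mix where "mix = stable_mixture \<eta> \<nu> n V"
  define T where "T = time_change mix W"
  define p where "p k t = state_prob M (time_change N T) k t" for k t
  define g where "g z = (\<eta> + lam powr \<nu> * (1 - z) powr \<nu>) powr \<delta> - \<eta> powr \<delta>" for z
  let ?F = "process_algebra M (count_space UNIV) {0..} N"
  let ?G = "process_algebra M borel {0..} T"
  have "n > 0"
    using \<open>\<nu> * real n > 0\<close> by (cases n) auto
  have indep: "indep_set (sets ?F) (sets ?G)"
    using indep_NT by (simp add: sets_process_algebra T_def mix_def)
  have N_F: "N s \<in> measurable ?F (count_space UNIV)" if "s \<ge> 0" for s
    using that by (intro measurable_process_algebra) auto
  have T_G: "T t \<in> borel_measurable ?G" if "t \<ge> 0" for t
    using that by (intro measurable_process_algebra) auto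
  \<comment> \<open>Independence of \<open>N\<close> and \<open>T\<close> includes that the algebra
    generated by \<open>T\<close> consists of events; measurability of \<open>T t\<close> comes from
    here.\<close>
  have "subalgebra M ?G"
    using indep_setD_ev2[OF indep] by (simp add: subalgebra_def)
  then have T_M: "T t \<in> borel_measurable M" if "t \<ge> 0" for t
    using T_G[OF that] by (rule measurable_from_subalg)
  have mix_0: "mix 0 \<omega> = 0" if "\<omega> \<in> space M" for \<omega>
    unfolding mix_def by (rule stable_mixture_0[OF stable that])
  have T_nonneg: "T t \<omega> \<ge> 0" if "t \<ge> 0" "\<omega> \<in> space M" for t \<omega>
    using stable_mixture_mono[where \<eta> = \<eta> and n = n, OF stable order_refl subordinator_nonneg[OF W that] that(2)] mix_0[OF that(2)]
    by (simp add: T_def mix_def time_change_def)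
  have N_right: "continuous (at_right s) (\<lambda>s. N s \<omega>)" if "\<omega> \<in> space M" "s \<ge> 0" for \<omega> s
    using assms(14) that by (simp add: poisson_process_def)
  have sums: "(\<lambda>k. p k t * z ^ k) sums exp (- t * g z)" if "t \<ge> 0" "\<bar>z\<bar> < 1" for t z
  proof -
    \<comment> \<open>The decay rate in \<open>s\<close> of the generating function of
      \<open>N s\<close> at \<open>z\<close>; \<open>\<bar>z\<bar> < 1\<close> makes it a
      nonnegative Laplace variable.\<close>
    define \<mu> where "\<mu> = lam * (1 - z)"
    have \<mu>: "\<mu> \<ge> 0"
      using \<open>lam > 0\<close> that by (simp add: \<mu>_def)
    have NT_M: "(\<lambda>\<omega>. N (T t \<omega>) \<omega>) \<in> measurable M (count_space UNIV)"
      by (rule measurable_right_continuous_time_change[where F = ?F and G = ?G])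
        (simp_all add: indep N_F T_G T_nonneg N_right that)
    have "expectation (\<lambda>\<omega>. z ^ N s \<omega>) = exp (- \<mu> * s)" if "s \<ge> 0" for s
      unfolding \<mu>_def
      using assms(14) \<open>lam > 0\<close> that \<open>\<bar>z\<bar> < 1\<close> by (intro poisson_process_generating_function) auto
    then have "expectation (\<lambda>\<omega>. z ^ N (T t \<omega>) \<omega>) = expectation (\<lambda>\<omega>. exp (- \<mu> * T t \<omega>))"
      by (intro expectation_right_continuous_time_change(2)[where F = ?F and G = ?G])
        (use that \<mu> in \<open>simp_all add: indep N_F T_G T_nonneg N_right\<close>)
    also have "\<dots> = exp (- t * ((\<eta> + \<mu> powr \<nu>) powr \<delta> - \<eta> powr \<delta>))"
      unfolding T_def mix_def
      by (rule subordinated_mixture_laplace[OF assms(3,6) \<open>n > 0\<close> \<mu> \<open>t \<ge> 0\<close> stable assms(10) W assms(12,13)])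
        (use T_M[OF \<open>t \<ge> 0\<close>] in \<open>simp_all add: T_def mix_def\<close>)
    also have "\<mu> powr \<nu> = lam powr \<nu> * (1 - z) powr \<nu>"
      using \<open>lam > 0\<close> that by (simp add: \<mu>_def powr_mult)
    finally have "expectation (\<lambda>\<omega>. z ^ N (T t \<omega>) \<omega>) = exp (- t * g z)"
      by (simp add: g_def)
    moreover have "(\<lambda>k. prob {\<omega> \<in> space M. N (T t \<omega>) \<omega> = k} * z ^ k) sums expectation (\<lambda>\<omega>. z ^ N (T t \<omega>) \<omega>)"
      by (rule sums_prob_generating_function[OF NT_M]) (use that in auto)
    ultimately show ?thesis
      by (simp add: p_def state_prob_def time_change_def)
  qed
  have "(p k has_real_derivative - backshift_series g (\<lambda>i. p i t) k) (at t within {0..})" if "t \<ge> 0" for k t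
  proof -
    \<comment> \<open>Only \<open>j \<le> k\<close> occurs, so the default value 0 of
      \<open>backshift\<close> is never reached.\<close>
    have "backshift_series g (\<lambda>i. p i t) k = (\<Sum>j\<le>k. (deriv ^^ j) g 0 / fact j * p (k - j) t)"
      unfolding backshift_series_def by (intro sum.cong) (simp_all add: backshift_funpow)
    then show ?thesis
      using exp_power_series_coeff_DERIV[of p g, OF sums that] by simp
  qed
  moreover have "p k 0 = (if k = 0 then 1 else 0)" for k
  proof -
    \<comment> \<open>All three layers start at 0 at every point: first \<open>W\<close>, then the
      mixture, then \<open>N\<close>.\<close>
    have "N (T 0 \<omega>) \<omega> = 0" if "\<omega> \<in> space M" for \<omega>
      using that W assms(14) mix_0[OF that]
      by (simp add: T_def time_change_def subordinator_def poisson_process_def)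
    then have "{\<omega> \<in> space M. N (T 0 \<omega>) \<omega> = k} = (if k = 0 then space M else {})"
      by auto
    then show ?thesis
      by (simp add: p_def state_prob_def time_change_def prob_space)
  qed
  ultimately show ?thesis
    by (simp add: p_def[abs_def] g_def[abs_def] T_def mix_def)
qed

end
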